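(* Let $(V,B)$ be a Steiner system of type $S(t,n,v)$, where $t<n\le v$, let $C=C_{(n,v)}\setminus B$, and let $X_C\subset\mathbb P^n$ be the Complement of the Steiner configuration of points with respect to a collection $\mathcal H=\{H_1,\dots,H_v\}$ of distinct hyperplanes of $\mathbb P^n$ any $n$ of which meet in a point. Then $$\operatorname{reg}(I_{X_C})=\alpha(I_{X_C})+1=v-n+1.$$
   Context: A Steiner system $(V,B)$ of type $S(t,n,v)$ consists of a set $V=\{1,\dots,v\}$ and a collection $B$ of $n$-subsets of $V$ (blocks) such that every $t$-subset of $V$ is contained in a unique block. $C_{(n,v)}$ denotes the set of all $n$-subsets of $V$. Let $H_j$ be defined by the linear form $\ell_j$ over the field $k$. For an $n$-subset $\sigma$ of $V$ put $P_\sigma=\bigcap_{i\in\sigma}H_i$, a point with ideal $I_{P_\sigma}=(\ell_i:i\in\sigma)\subseteq R=k[x_0,\dots,x_n]$. Then $X_C=\{P_\sigma:\sigma\in C\}$ and $I_{X_C}=\bigcap_{\sigma\in C}I_{P_\sigma}$. $\alpha(I)$ is the minimum integer $d$ with $I_d\neq0$. For the ideal $I$ of a finite set of points, the Castelnuovo-Mumford regularity $\operatorname{reg}(I)$ is the least degree $s>0$ such that $\dim_k(R/I)_s=\dim_k(R/I)_{s-1}$.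
   Formalization: The formal theorem also assumes that the points P_σ, for all n-subsets σ of V, are pairwise distinct (false otherwise, e.g. four concurrent lines in P^2 with B={12,34}) and that n ≥ 2 (false for t=0, n=1, v ≥ 2). *)

theory Defs
  imports
    "HOL-Analysis.Cartesian_Space"
    "HOL-Library.Poly_Mapping"
    "HOL-Algebra.QuotRing"
    "HOL-Algebra.Embedded_Algebras"
    "HOL-Algebra.Algebraic_Closure_Type"
begin

section \<open>Steiner systems\<close>

definition subsets_of_size :: "nat \<Rightarrow> nat \<Rightarrow> nat set set" where
  "subsets_of_size n v = {\<sigma>. \<sigma> \<subseteq> {1..v} \<and> card \<sigma> = n}"

definition steiner_system :: "nat \<Rightarrow> nat \<Rightarrow> nat \<Rightarrow> nat set set \<Rightarrow> bool" where
  "steiner_system t n v B \<longleftrightarrow>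
     B \<subseteq> subsets_of_size n v \<and> (\<forall>T\<in>subsets_of_size t v. \<exists>!b. b \<in> B \<and> T \<subseteq> b)"


section \<open>The polynomial ring and projective space\<close>

text \<open>The variables are indexed by a finite type \<open>'x\<close>; with \<open>CARD('x) = n + 1\<close> the type below
  is \<open>k[x\<^sub>0, \<dots>, x\<^sub>n]\<close>, and \<open>proj_space\<close> is the set of its \<open>k\<close>-rational projective points.\<close>

type_synonym ('x, 'k) polys = "('x \<Rightarrow>\<^sub>0 nat) \<Rightarrow>\<^sub>0 'k"

abbreviation poly_ring :: "('x, 'k::field) polys ring" where
  "poly_ring \<equiv> ring_of_type_algebra"

definition graded_part :: "nat \<Rightarrow> ('x::finite, 'k::field) polys set" where
  "graded_part d =
     {f. \<forall>m\<in>Poly_Mapping.keys f. (\<Sum>x\<in>UNIV. Poly_Mapping.lookup m x) = d}"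

definition eval_poly :: "('x::finite, 'k::field) polys \<Rightarrow> 'k ^ 'x \<Rightarrow> 'k" where
  "eval_poly f a =
     (\<Sum>m\<in>Poly_Mapping.keys f.
        Poly_Mapping.lookup f m * (\<Prod>x\<in>UNIV. (a $ x) ^ Poly_Mapping.lookup m x))"

text \<open>Projective points are the lines through the origin.\<close>

definition proj_space :: "('k::field ^ 'x::finite) set set" where
  "proj_space = {L. vec.subspace L \<and> vec.dim L = 1}"

definition hyperplane :: "('x::finite, 'k::field) polys \<Rightarrow> ('k ^ 'x) set set" where
  "hyperplane l = {L \<in> proj_space. \<forall>a\<in>L. eval_poly l a = 0}"


section \<open>Ideals of configurations\<close>

definition point_ideal :: "(nat \<Rightarrow> ('x::finite, 'k::field) polys) \<Rightarrow> nat set \<Rightarrow> ('x, 'k) polys set"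
  where "point_ideal l \<sigma> = genideal poly_ring (l ` \<sigma>)"

text \<open>The point \<open>P\<^sub>\<sigma>\<close> is the common point of the hyperplanes \<open>l i\<close>, \<open>i \<in> \<sigma>\<close>, and the configuration
  \<open>X\<^sub>C\<close> is given by its index set \<open>C\<close>. For empty \<open>C\<close> the ideal is the whole ring.\<close>

definition config_ideal ::
  "(nat \<Rightarrow> ('x::finite, 'k::field) polys) \<Rightarrow> nat set set \<Rightarrow> ('x, 'k) polys set"
  where "config_ideal l C = (\<Inter>\<sigma>\<in>C. point_ideal l \<sigma>)"

definition initial_degree :: "('x::finite, 'k::field) polys set \<Rightarrow> nat" where
  "initial_degree I = (LEAST d. \<exists>f \<in> I \<inter> graded_part d. f \<noteq> 0)"

text \<open>\<open>dim\<^sub>k (R/I)\<^sub>d\<close>: inside the quotient ring, \<open>k\<close> is the image of the constant polynomials and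
  \<open>(R/I)\<^sub>d\<close> is the image of \<open>R\<^sub>d\<close>. If \<open>I\<close> is the whole ring, the dimension is still the
  expected \<open>0\<close>.\<close>

definition hilbert_function :: "('x::finite, 'k::field) polys set \<Rightarrow> nat \<Rightarrow> nat" where
  "hilbert_function I d =
     ring.dim (poly_ring Quot I)
       (range (\<lambda>c. a_r_coset poly_ring I (Poly_Mapping.single 0 c)))
       (a_r_coset poly_ring I ` graded_part d)"

text \<open>Castelnuovo--Mumford regularity of the ideal of a finite set of points, in terms of the
  Hilbert function.\<close>

definition points_regularity :: "('x::finite, 'k::field) polys set \<Rightarrow> nat" where
  "points_regularity I =
     (LEAST s. 0 < s \<and> hilbert_function I s = hilbert_function I (s - 1))"

end

theory Submission
  imports Defs
begin

text \<open>For \<open>W \<subseteq> {1..v}\<close> with \<open>|W| \<ge> n\<close>, the products \<open>F\<^sub>\<sigma>\<close> of the \<open>l i\<close>, \<open>i \<in> W - \<sigma>\<close>, where \<open>\<sigma>\<close>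
  ranges over the \<open>n\<close>-subsets of \<open>W\<close>, are dual to the points \<open>P\<^sub>\<sigma>\<close> and as many as the monomials of
  degree \<open>|W| - n\<close>, hence a basis of the forms of that degree. Expanding a form in this basis for a
  suitable \<open>W\<close> shows that no nonzero form of degree less than \<open>v - n\<close> vanishes on the complement of
  the blocks, because two blocks never share \<open>n - 1\<close> elements; for \<open>W = {1..v}\<close> and a block \<open>b\<close>, the
  form \<open>F\<^sub>b\<close> does vanish there. So the Hilbert function is that of the polynomial ring below degree
  \<open>v - n\<close>, and it equals the number of points from degree \<open>v - n\<close> on. It still increases strictly in
  degree \<open>v - n\<close>, since counting \<open>(n-1)\<close>-subsets of blocks gives \<open>|B| < binom (v-1) (n-1)\<close>.\<close>

section \<open>Polynomials as a graded vector space\<close>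

text \<open>Scaling is multiplication by a constant polynomial, so every ideal is a subspace and the
  scalars agree with the copy of \<open>k\<close> used in \<open>hilbert_function\<close>.\<close>

definition poly_scale :: "'k::field \<Rightarrow> ('x::finite, 'k) polys \<Rightarrow> ('x, 'k) polys" where
  "poly_scale c f = Poly_Mapping.single 0 c * f"

lemma lookup_poly_scale [simp]:
  "Poly_Mapping.lookup (poly_scale c f) m = c * Poly_Mapping.lookup f m"
  unfolding poly_scale_def by (simp add: mult_map_scale_conv_mult[symmetric] Poly_Mapping.map.rep_eq when_def)

interpretation pv: vector_space poly_scale
  by unfold_locales (auto intro!: poly_mapping_eqI simp: lookup_add algebra_simps)

interpretation scalars: vector_space_pair poly_scale "(*) :: 'k::field \<Rightarrow> 'k \<Rightarrow> 'k"
  by unfold_locales (auto simp: algebra_simps)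

definition monomials :: "nat \<Rightarrow> ('x::finite \<Rightarrow>\<^sub>0 nat) set" where
  "monomials d = {m. (\<Sum>x\<in>UNIV. Poly_Mapping.lookup m x) = d}"

lemma graded_part_iff: "f \<in> graded_part d \<longleftrightarrow> Poly_Mapping.keys f \<subseteq> monomials d"
  by (auto simp: graded_part_def monomials_def)

lemma poly_eq_sum_monomials:
  "f = (\<Sum>m\<in>Poly_Mapping.keys f. poly_scale (Poly_Mapping.lookup f m) (Poly_Mapping.single m 1))"
proof (rule poly_mapping_eqI)
  fix k
  show "Poly_Mapping.lookup f k = Poly_Mapping.lookup
    (\<Sum>m\<in>Poly_Mapping.keys f. poly_scale (Poly_Mapping.lookup f m) (Poly_Mapping.single m 1)) k"
    by (auto simp: lookup_sum lookup_single when_def if_distrib sum.delta in_keys_iff cong: if_cong)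
qed

lemma subspace_graded_part: "pv.subspace (graded_part d)"
proof (rule pv.subspaceI)
  show "0 \<in> graded_part d" by (simp add: graded_part_def)
  show "f + g \<in> graded_part d" if "f \<in> graded_part d" "g \<in> graded_part d" for f g
    using that keys_add[of f g] by (auto simp: graded_part_iff)
  show "poly_scale c f \<in> graded_part d" if "f \<in> graded_part d" for c f
    using that by (auto simp: graded_part_iff in_keys_iff)
qed

lemma graded_part_mult:
  assumes "f \<in> graded_part d" "g \<in> graded_part e"
  shows "f * g \<in> graded_part (d + e)"
proof -
  have "a + b \<in> monomials (d + e)" if "a \<in> monomials d" "b \<in> monomials e" for a b :: "'a \<Rightarrow>\<^sub>0 nat"
    using that by (simp add: monomials_def lookup_add sum.distrib)
  then show ?thesis
    using assms keys_mult[of f g] unfolding graded_part_iff by blast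
qed

lemma one_in_graded_part: "1 \<in> graded_part 0"
  by (simp add: graded_part_def)

lemma graded_part_prod:
  assumes "finite A" "\<And>i. i \<in> A \<Longrightarrow> f i \<in> graded_part 1"
  shows "(\<Prod>i\<in>A. f i) \<in> graded_part (card A)"
  using assms
proof (induction A)
  case empty
  then show ?case by (simp add: one_in_graded_part)
next
  case (insert i A)
  then show ?case using graded_part_mult[of "f i" 1 "\<Prod>i\<in>A. f i" "card A"] by simp
qed

definition var :: "'x::finite \<Rightarrow> ('x, 'k::field) polys" where
  "var j = Poly_Mapping.single (Poly_Mapping.single j 1) 1"

lemma var_in_graded_part: "var j \<in> graded_part 1"
  by (simp add: var_def graded_part_def lookup_single when_def)

lemma graded_part_power:
  assumes "f \<in> graded_part 1"
  shows "f ^ e \<in> graded_part e"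
  using graded_part_prod[of "{..<e}" "\<lambda>_. f"] assms by simp


text \<open>Stars and bars: listing the variables turns exponent vectors into lists of
  \<open>CARD('x)\<close> natural numbers with sum \<open>d\<close>.\<close>

lemma finite_monomials [simp]: "finite (monomials d :: ('x::finite \<Rightarrow>\<^sub>0 nat) set)"
  and card_monomials: "card (monomials d :: ('x::finite \<Rightarrow>\<^sub>0 nat) set) = (d + CARD('x) - 1) choose d"
proof -
  obtain xs :: "'x list" where xs: "set xs = UNIV" "distinct xs"
    using finite_distinct_list[of "UNIV :: 'x set"] by auto
  have len: "length xs = CARD('x)"
    using xs distinct_card by fastforce
  let ?L = "{l::nat list. length l = CARD('x) \<and> sum_list l = d}"
  have "bij_betw (\<lambda>m. map (Poly_Mapping.lookup m) xs) (monomials d) ?L"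
  \<comment> \<open>The inverse reads a list as a function on the variables, which has finite
    support because there are finitely many variables.\<close>
  proof (rule bij_betwI[where g = "\<lambda>l. Abs_poly_mapping (\<lambda>x. the (map_of (zip xs l) x))"])
    show "(\<lambda>m. map (Poly_Mapping.lookup m) xs) \<in> monomials d \<rightarrow> ?L"
      using xs len by (auto simp: monomials_def sum_list_distinct_conv_sum_set)
    have eq: "map (\<lambda>x. the (map_of (zip xs l) x)) xs = l" if "length l = CARD('x)" for l :: "nat list"
      using that len xs by (auto intro!: nth_equalityI simp: map_of_zip_nth)
    show "(\<lambda>l. Abs_poly_mapping (\<lambda>x. the (map_of (zip xs l) x))) \<in> ?L \<rightarrow> monomials d"
    proof
      fix l assume l: "l \<in> ?L"
      have "(\<Sum>x\<in>UNIV. the (map_of (zip xs l) x)) = sum_list l"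
        using sum_list_distinct_conv_sum_set[OF xs(2), of "\<lambda>x. the (map_of (zip xs l) x)"] eq[of l] l xs
        by simp
      then show "Abs_poly_mapping (\<lambda>x. the (map_of (zip xs l) x)) \<in> monomials d"
        using l by (simp add: monomials_def)
    qed
    show "map (Poly_Mapping.lookup (Abs_poly_mapping (\<lambda>x. the (map_of (zip xs l) x)))) xs = l"
      if "l \<in> ?L" for l
      using eq[of l] that by simp
    show "Abs_poly_mapping (\<lambda>x. the (map_of (zip xs (map (Poly_Mapping.lookup m) xs)) x)) = m"
      if "m \<in> monomials d" for m
      by (rule poly_mapping_eqI) (use xs in \<open>simp add: map_of_zip_map\<close>)
  qed
  moreover have "finite ?L"
    by (rule finite_subset[OF _ finite_lists_length_eq[of "{..d}" "CARD('x)"]])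
      (auto dest: member_le_sum_list)
  ultimately show "finite (monomials d :: ('x::finite \<Rightarrow>\<^sub>0 nat) set)"
    and "card (monomials d :: ('x::finite \<Rightarrow>\<^sub>0 nat) set) = (d + CARD('x) - 1) choose d"
    using bij_betw_finite bij_betw_same_card card_length_sum_list[of "CARD('x)" d] by fastforce+
qed

section \<open>The monomial basis of a graded part\<close>

abbreviation monomial_basis :: "nat \<Rightarrow> ('x::finite, 'k::field) polys set" where
  "monomial_basis d \<equiv> (\<lambda>m. Poly_Mapping.single m 1) ` monomials d"

lemma inj_single_one: "inj_on (\<lambda>m. Poly_Mapping.single m (1::'k::field)) A"
  by (rule inj_onI) (metis lookup_single_eq lookup_single_not_eq zero_neq_one)

lemma span_monomial_basis: "pv.span (monomial_basis d :: ('x::finite, 'k::field) polys set) = graded_part d"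
proof
  show "pv.span (monomial_basis d :: ('x, 'k) polys set) \<subseteq> graded_part d"
    by (rule pv.span_minimal) (auto simp: graded_part_iff subspace_graded_part)
  show "(graded_part d :: ('x, 'k) polys set) \<subseteq> pv.span (monomial_basis d)"
  proof
    fix f :: "('x, 'k) polys" assume "f \<in> graded_part d"
    then have "(\<Sum>m\<in>Poly_Mapping.keys f. poly_scale (Poly_Mapping.lookup f m) (Poly_Mapping.single m 1))
        \<in> pv.span (monomial_basis d)"
      by (intro pv.span_sum, intro pv.span_scale, intro pv.span_base) (auto simp: graded_part_iff)
    then show "f \<in> pv.span (monomial_basis d)"
      using poly_eq_sum_monomials[of f] by simp
  qed
qed

lemma independent_monomial_basis:
  "pv.independent (monomial_basis d :: ('x::finite, 'k::field) polys set)" (is "pv.independent ?B")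
proof (rule pv.independent_if_scalars_zero)
  fix u and f :: "('x, 'k) polys"
  assume sum: "(\<Sum>g\<in>?B. poly_scale (u g) g) = 0" and "f \<in> ?B"
  then obtain m where m: "m \<in> monomials d" "f = Poly_Mapping.single m 1" by auto
  have "0 = Poly_Mapping.lookup (\<Sum>m\<in>monomials d. poly_scale (u (Poly_Mapping.single m 1)) (Poly_Mapping.single m 1)) m"
    using sum by (simp add: sum.reindex inj_single_one)
  also have "\<dots> = u f"
    using m by (simp add: lookup_sum lookup_single when_def if_distrib sum.delta cong: if_cong)
  finally show "u f = 0" by simp
qed simp

lemma card_monomial_basis:
  "card (monomial_basis d :: ('x::finite, 'k::field) polys set) = (d + CARD('x) - 1) choose d"
  by (simp add: card_image inj_single_one card_monomials)

section \<open>Evaluation\<close>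

lemma eval_poly_superset:
  assumes "finite S" "Poly_Mapping.keys f \<subseteq> S"
  shows "eval_poly f a = (\<Sum>m\<in>S. Poly_Mapping.lookup f m * (\<Prod>x\<in>UNIV. (a $ x) ^ Poly_Mapping.lookup m x))"
  unfolding eval_poly_def by (rule sum.mono_neutral_left) (use assms in \<open>auto simp: in_keys_iff\<close>)

lemma eval_poly_add: "eval_poly (f + g) a = eval_poly f a + eval_poly g a"
proof -
  let ?S = "Poly_Mapping.keys f \<union> Poly_Mapping.keys g"
  have "Poly_Mapping.keys (f + g) \<subseteq> ?S" by (rule keys_add)
  then show ?thesis
    by (simp add: eval_poly_superset[of ?S] lookup_add algebra_simps sum.distrib)
qed

lemma eval_poly_scale: "eval_poly (poly_scale c f) a = c * eval_poly f a"
proof -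
  have "Poly_Mapping.keys (poly_scale c f) \<subseteq> Poly_Mapping.keys f"
    by (auto simp: in_keys_iff)
  then show ?thesis
    by (simp add: eval_poly_superset[of "Poly_Mapping.keys f"] sum_distrib_left mult.assoc)
qed

lemma linear_eval_poly: "Vector_Spaces.linear poly_scale (*) (\<lambda>f. eval_poly f a)"
  unfolding Vector_Spaces.linear_iff
  by (intro conjI pv.vector_space_axioms; (unfold_locales)?)
    (auto simp: algebra_simps eval_poly_add eval_poly_scale)

lemmas eval_poly_linear_simps =
  eval_poly_add eval_poly_scale scalars.linear_0[OF linear_eval_poly]
  scalars.linear_diff[OF linear_eval_poly] scalars.linear_sum[OF linear_eval_poly]

lemma eval_poly_single:
  "eval_poly (Poly_Mapping.single m c) a = c * (\<Prod>x\<in>UNIV. (a $ x) ^ Poly_Mapping.lookup m x)"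
  by (simp add: eval_poly_def)

text \<open>Expanding \<open>f\<close> and then \<open>g\<close> in monomials reduces this to two
  monomials, whose exponents add.\<close>

lemma eval_poly_mult: "eval_poly (f * g) a = eval_poly f a * eval_poly g a"
proof -
  have single: "eval_poly (Poly_Mapping.single m 1 * g) a =
      eval_poly (Poly_Mapping.single m 1) a * eval_poly g a" for m
  proof -
    have "Poly_Mapping.single m 1 * g =
      (\<Sum>m'\<in>Poly_Mapping.keys g. poly_scale (Poly_Mapping.lookup g m') (Poly_Mapping.single (m + m') 1))"
      by (subst poly_eq_sum_monomials[of g])
        (simp add: sum_distrib_left poly_scale_def mult_single)
    then show ?thesis
      by (simp add: eval_poly_linear_simps eval_poly_single lookup_add power_add prod.distrib)
        (simp add: eval_poly_def sum_distrib_left algebra_simps)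
  qed
  have "f * g = (\<Sum>m\<in>Poly_Mapping.keys f. poly_scale (Poly_Mapping.lookup f m) (Poly_Mapping.single m 1 * g))"
    by (subst poly_eq_sum_monomials[of f]) (simp add: sum_distrib_right poly_scale_def mult.assoc)
  also have "eval_poly \<dots> a = eval_poly f a * eval_poly g a"
    by (simp add: eval_poly_linear_simps single)
      (simp add: eval_poly_single eval_poly_def[of f] sum_distrib_right mult.assoc)
  finally show ?thesis .
qed

lemma eval_poly_one [simp]: "eval_poly 1 a = 1"
  by (simp add: eval_poly_def)

lemma eval_poly_prod: "eval_poly (\<Prod>i\<in>A. f i) a = (\<Prod>i\<in>A. eval_poly (f i) a)"
  by (induction A rule: infinite_finite_induct) (simp_all add: eval_poly_mult)

lemma eval_poly_power: "eval_poly (f ^ e) a = eval_poly f a ^ e"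
  by (induction e) (simp_all add: eval_poly_mult)

lemma eval_poly_var [simp]: "eval_poly (var j) a = a $ j"
proof -
  have "(a $ x) ^ Poly_Mapping.lookup (Poly_Mapping.single j 1) x = (if x = j then a $ x else 1)" for x
    by (simp add: lookup_single when_def)
  then show ?thesis
    by (simp add: var_def eval_poly_single)
qed

lemma eval_poly_homogeneous:
  assumes "f \<in> graded_part d"
  shows "eval_poly f (c *s a) = c ^ d * eval_poly f a"
proof -
  have "(\<Prod>x\<in>UNIV. ((c *s a) $ x) ^ Poly_Mapping.lookup m x) =
      c ^ d * (\<Prod>x\<in>UNIV. (a $ x) ^ Poly_Mapping.lookup m x)" if "m \<in> Poly_Mapping.keys f" for m
  proof -
    have "(\<Sum>x\<in>UNIV. Poly_Mapping.lookup m x) = d"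
      using assms that by (auto simp: graded_part_def)
    then show ?thesis
      by (simp add: power_mult_distrib prod.distrib power_sum[symmetric])
  qed
  then show ?thesis
    by (simp add: eval_poly_def sum_distrib_left algebra_simps)
qed

section \<open>Products of variables, and linear forms\<close>

lemma poly_scale_mult:
  fixes f g :: "('x::finite, 'k::field) polys"
  shows "poly_scale c f * poly_scale d g = poly_scale (c * d) (f * g)"
proof -
  have "Poly_Mapping.single 0 (c * d) = (Poly_Mapping.single 0 c * Poly_Mapping.single 0 d :: ('x, 'k) polys)"
    by (simp add: mult_single)
  then show ?thesis by (simp add: poly_scale_def ac_simps)
qed

lemma var_power: "(var k :: ('x::finite, 'k::field) polys) ^ e = Poly_Mapping.single (Poly_Mapping.single k e) 1"
  by (induction e) (simp_all add: var_def mult_single flip: single_add)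

lemma prod_single:
  "finite A \<Longrightarrow> (\<Prod>k\<in>A. Poly_Mapping.single (m k) 1) = (Poly_Mapping.single (\<Sum>k\<in>A. m k) 1 :: ('x::finite, 'k::field) polys)"
  by (induction A rule: finite_induct) (simp_all add: mult_single)

text \<open>Congruences modulo an ideal pass through products and powers, so this lifts them from
  variables to monomials.\<close>

lemma monomial_eq_prod_var:
  "Poly_Mapping.single m 1 = (\<Prod>k\<in>UNIV. (var k :: ('x::finite, 'k::field) polys) ^ Poly_Mapping.lookup m k)"
proof -
  have "(\<Sum>k\<in>UNIV. Poly_Mapping.single k (Poly_Mapping.lookup m k)) = m"
    by (rule poly_mapping_eqI) (simp add: lookup_sum lookup_single when_def sum.delta)
  then show ?thesis
    by (simp add: var_power prod_single)
qed

lemma monomials_1: "(monomials 1 :: ('x::finite \<Rightarrow>\<^sub>0 nat) set) = range (\<lambda>j. Poly_Mapping.single j 1)"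
proof
  show "(monomials 1 :: ('x::finite \<Rightarrow>\<^sub>0 nat) set) \<subseteq> range (\<lambda>j. Poly_Mapping.single j 1)"
  proof
    fix m :: "'x \<Rightarrow>\<^sub>0 nat" assume "m \<in> monomials 1"
    then have "(\<Sum>x\<in>UNIV. Poly_Mapping.lookup m x) = 1" by (simp add: monomials_def)
    then obtain j where "Poly_Mapping.lookup m j = 1" "\<And>x. x \<noteq> j \<Longrightarrow> Poly_Mapping.lookup m x = 0"
      by (auto simp: sum_eq_Suc0_iff)
    then have "m = Poly_Mapping.single j 1"
      by (intro poly_mapping_eqI) (auto simp: lookup_single when_def)
    then show "m \<in> range (\<lambda>j. Poly_Mapping.single j 1)" by blast
  qed
qed (auto simp: monomials_def lookup_single when_def)

lemma monomial_basis_1: "monomial_basis 1 = range var"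
  unfolding monomials_1 var_def by auto

text \<open>A linear functional on linear forms is evaluation at a vector, so a linear form outside the
  span of \<open>S\<close> is separated from \<open>S\<close> by a point.\<close>

lemma linear_form_in_span:
  fixes S :: "('x::finite, 'k::field) polys set"
  assumes S: "S \<subseteq> graded_part 1" and L: "L \<in> graded_part 1"
    and vanish: "\<And>a. (\<And>g. g \<in> S \<Longrightarrow> eval_poly g a = 0) \<Longrightarrow> eval_poly L a = 0"
  shows "L \<in> pv.span S"
proof (rule ccontr)
  assume notin: "L \<notin> pv.span S"
  obtain B where B: "B \<subseteq> S" "pv.independent B" "S \<subseteq> pv.span B"
    using pv.maximal_independent_subset by blast
  have "L \<notin> pv.span B" using notin B(1) pv.span_mono by blast
  then have "pv.independent (insert L B)" "L \<notin> B"
    using B(2) pv.independent_insertI pv.span_base by blast+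
  then obtain \<phi> where \<phi>: "Vector_Spaces.linear poly_scale (*) \<phi>"
      "\<And>x. x \<in> insert L B \<Longrightarrow> \<phi> x = (if x = L then 1 else 0)"
    using scalars.linear_independent_extend[of "insert L B" "\<lambda>x. if x = L then 1 else 0"] by blast
  \<comment> \<open>The values of \<open>\<phi>\<close> at the variables serve as coordinates; the
    variables span the linear forms, so \<open>\<phi>\<close> is evaluation at this vector.\<close>
  let ?a = "\<chi> j. \<phi> (var j)"
  have eval: "\<phi> f = eval_poly f ?a" if "f \<in> graded_part 1" for f
  proof (rule scalars.linear_eq_on[OF \<phi>(1) linear_eval_poly])
    show "f \<in> pv.span (monomial_basis 1)" using that by (simp add: span_monomial_basis)
    show "\<phi> b = eval_poly b ?a" if "b \<in> monomial_basis 1" for b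
      using that by (auto simp only: monomial_basis_1 eval_poly_var vec_lambda_beta)
  qed
  have "eval_poly g ?a = 0" if "g \<in> S" for g
  proof -
    have "\<phi> g = 0"
    proof (rule scalars.linear_eq_0_on_span[OF \<phi>(1)])
      show "g \<in> pv.span B" using B(3) that by blast
      show "\<phi> x = 0" if "x \<in> B" for x using \<phi>(2)[of x] that \<open>L \<notin> B\<close> by auto
    qed
    then show ?thesis using eval S that by auto
  qed
  then have "\<phi> L = 0" using vanish eval L by simp
  then show False using \<phi>(2)[of L] by simp
qed

section \<open>Ideals of the polynomial ring\<close>

lemma poly_ring_simps [simp]:
  "carrier poly_ring = UNIV" "a \<oplus>\<^bsub>poly_ring\<^esub> b = a + b" "a \<otimes>\<^bsub>poly_ring\<^esub> b = a * b"
  "\<zero>\<^bsub>poly_ring\<^esub> = 0" "\<one>\<^bsub>poly_ring\<^esub> = 1"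
  by (simp_all add: ring_of_type_algebra_def)

interpretation poly_ring: cring "poly_ring :: ('x::finite, 'k::field) polys ring"
  by (rule cring_from_type_algebra)

lemma ideal_poly_ringI:
  assumes "0 \<in> I" "\<And>f g. f \<in> I \<Longrightarrow> g \<in> I \<Longrightarrow> f + g \<in> I" "\<And>f g. g \<in> I \<Longrightarrow> f * g \<in> I"
  shows "ideal I (poly_ring :: ('x::finite, 'k::field) polys ring)"
proof (rule idealI)
  show "subgroup I (add_monoid (poly_ring :: ('x::finite, 'k::field) polys ring))"
  proof (rule poly_ring.add.subgroupI)
    show "\<ominus>\<^bsub>poly_ring\<^esub> a \<in> I" if "a \<in> I" for a
    proof -
      have "\<ominus>\<^bsub>poly_ring\<^esub> a = (- 1) * a"
        by (rule poly_ring.minus_equality) simp_all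
      then show ?thesis using assms(3)[OF that, of "- 1"] by simp
    qed
  qed (use assms in auto)
qed (use assms in \<open>auto simp: mult.commute poly_ring.ring_axioms\<close>)

context
  fixes I :: "('x::finite, 'k::field) polys set"
  assumes I: "ideal I poly_ring"
begin

lemma ideal_zero: "0 \<in> I"
  using additive_subgroup.zero_closed[OF ideal.axioms(1)[OF I]] by simp

lemma ideal_add: "f \<in> I \<Longrightarrow> g \<in> I \<Longrightarrow> f + g \<in> I"
  using additive_subgroup.a_closed[OF ideal.axioms(1)[OF I]] by simp

lemma ideal_mult: "g \<in> I \<Longrightarrow> f * g \<in> I"
  using ideal.I_l_closed[OF I] by simp

lemma ideal_scale: "f \<in> I \<Longrightarrow> poly_scale c f \<in> I"
  unfolding poly_scale_def by (rule ideal_mult)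

lemma subspace_ideal: "pv.subspace I"
  by (intro pv.subspaceI ideal_zero ideal_add ideal_scale)

lemma ideal_cong_mult:
  assumes "f - f' \<in> I" "g - g' \<in> I"
  shows "f * g - f' * g' \<in> I"
proof -
  have "f * g - f' * g' = f * (g - g') + g' * (f - f')" by (simp add: algebra_simps)
  then show ?thesis using assms ideal_add ideal_mult by metis
qed

lemma ideal_cong_prod:
  "(\<And>k. k \<in> A \<Longrightarrow> f k - g k \<in> I) \<Longrightarrow> (\<Prod>k\<in>A. f k) - (\<Prod>k\<in>A. g k) \<in> I"
  by (induction A rule: infinite_finite_induct) (simp_all add: ideal_zero ideal_cong_mult)

lemma ideal_cong_power: "f - g \<in> I \<Longrightarrow> f ^ e - g ^ e \<in> I"
  using ideal_cong_prod[of "{..<e}" "\<lambda>_. f" "\<lambda>_. g"] by simp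

text \<open>Modulo \<open>I\<close> each variable is a multiple of \<open>var j\<close>, so a
  monomial of degree \<open>d\<close> becomes its value at \<open>a\<close> times
  \<open>var j ^ d\<close>; linearity does the rest.\<close>

lemma homogeneous_cong_var_power:
  assumes var: "\<And>k. var k - poly_scale (a $ k) (var j) \<in> I" and f: "f \<in> graded_part d"
  shows "f - poly_scale (eval_poly f a) (var j ^ d) \<in> I"
proof -
  have scale_power: "poly_scale c g ^ e = poly_scale (c ^ e) (g ^ e)" for c :: 'k and g :: "('x, 'k) polys" and e
    by (induction e) (simp_all add: poly_scale_mult)
  have scale_prod: "(\<Prod>k\<in>A. poly_scale (c k) (g k)) = poly_scale (\<Prod>k\<in>A. c k) (\<Prod>k\<in>A. g k)"
    if "finite A" for A :: "'x set" and c and g :: "'x \<Rightarrow> ('x, 'k) polys"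
    using that by (induction A) (simp_all add: poly_scale_mult)
  have monomial: "Poly_Mapping.single m 1 - poly_scale (eval_poly (Poly_Mapping.single m 1) a) (var j ^ d) \<in> I"
    if "m \<in> Poly_Mapping.keys f" for m
  proof -
    have "(\<Sum>x\<in>UNIV. Poly_Mapping.lookup m x) = d"
      using that f by (auto simp: graded_part_def)
    then have "(\<Prod>k\<in>UNIV. poly_scale (a $ k) (var j) ^ Poly_Mapping.lookup m k) =
        poly_scale (eval_poly (Poly_Mapping.single m 1) a) (var j ^ d)"
      by (simp add: scale_power scale_prod eval_poly_single flip: power_sum)
    then show ?thesis
      using ideal_cong_prod[of UNIV "\<lambda>k. var k ^ Poly_Mapping.lookup m k"
          "\<lambda>k. poly_scale (a $ k) (var j) ^ Poly_Mapping.lookup m k"] ideal_cong_power[OF var]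
      by (simp add: monomial_eq_prod_var)
  qed
  let ?c = "Poly_Mapping.lookup f"
  have "f - poly_scale (eval_poly f a) (var j ^ d) = (\<Sum>m\<in>Poly_Mapping.keys f. poly_scale (?c m)
    (Poly_Mapping.single m 1 - poly_scale (eval_poly (Poly_Mapping.single m 1) a) (var j ^ d)))"
  proof -
    have "poly_scale (eval_poly f a) (var j ^ d) = (\<Sum>m\<in>Poly_Mapping.keys f. poly_scale (?c m)
      (poly_scale (eval_poly (Poly_Mapping.single m 1) a) (var j ^ d)))"
      by (simp add: eval_poly_def[of f] eval_poly_single pv.scale_sum_left)
    then show ?thesis
      by (subst (1) poly_eq_sum_monomials[of f]) (simp add: pv.scale_right_diff_distrib sum_subtractf)
  qed
  also have "\<dots> \<in> I"
    by (intro pv.subspace_sum[OF subspace_ideal] ideal_scale monomial)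
  finally show ?thesis .
qed

end

section \<open>Ideals of points\<close>

lemma ideal_vanishing: "ideal {f. eval_poly f a = 0} poly_ring"
  by (rule ideal_poly_ringI) (auto simp: eval_poly_linear_simps eval_poly_mult)

lemma ideal_point_ideal: "ideal (point_ideal l \<sigma>) poly_ring"
  unfolding point_ideal_def by (rule poly_ring.genideal_ideal) simp

lemma ideal_config_ideal:
  assumes "C \<noteq> {}"
  shows "ideal (config_ideal l C) poly_ring"
  unfolding config_ideal_def using assms by (auto intro!: poly_ring.i_Intersect ideal_point_ideal)

lemma eval_poly_point_ideal:
  assumes "f \<in> point_ideal l \<sigma>" "\<And>i. i \<in> \<sigma> \<Longrightarrow> eval_poly (l i) a = 0"
  shows "eval_poly f a = 0"
proof -
  have "point_ideal l \<sigma> \<subseteq> {f. eval_poly f a = 0}"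
    unfolding point_ideal_def
    by (rule poly_ring.genideal_minimal[OF ideal_vanishing]) (use assms(2) in auto)
  then show ?thesis using assms(1) by auto
qed

text \<open>For the direction from right to left: \<open>var k\<close> minus
  \<open>a $ k / a $ j\<close> times \<open>var j\<close> vanishes on the line of common zeros of
  the \<open>l i\<close>, hence lies in their span. Modulo the ideal, \<open>f\<close> is then
  \<open>var j ^ d\<close> times its value at a multiple of \<open>a\<close>, which is zero.\<close>

lemma homogeneous_in_point_ideal_iff:
  fixes l :: "nat \<Rightarrow> ('x::finite, 'k::field) polys"
  assumes l: "\<And>i. i \<in> \<sigma> \<Longrightarrow> l i \<in> graded_part 1"
    and a: "a \<noteq> 0" "\<And>i. i \<in> \<sigma> \<Longrightarrow> eval_poly (l i) a = 0"
    and line: "\<And>b. (\<And>i. i \<in> \<sigma> \<Longrightarrow> eval_poly (l i) b = 0) \<Longrightarrow> \<exists>c. b = c *s a"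
    and f: "f \<in> graded_part d"
  shows "f \<in> point_ideal l \<sigma> \<longleftrightarrow> eval_poly f a = 0"
proof
  assume eval: "eval_poly f a = 0"
  obtain j where j: "a $ j \<noteq> 0" using a(1) by (auto simp: vec_eq_iff)
  let ?a = "inverse (a $ j) *s a"
  let ?I = "point_ideal l \<sigma>"
  have "l ` \<sigma> \<subseteq> ?I"
    unfolding point_ideal_def by (rule poly_ring.genideal_self) simp
  then have span: "pv.span (l ` \<sigma>) \<subseteq> ?I"
    by (rule pv.span_minimal) (rule subspace_ideal[OF ideal_point_ideal])
  have "var k - poly_scale (?a $ k) (var j) \<in> pv.span (l ` \<sigma>)" for k
  proof (rule linear_form_in_span)
    show "l ` \<sigma> \<subseteq> graded_part 1" using l by auto
    show "var k - poly_scale (?a $ k) (var j) \<in> graded_part 1"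
      by (intro pv.subspace_diff pv.subspace_scale subspace_graded_part var_in_graded_part)
    fix b assume "\<And>g. g \<in> l ` \<sigma> \<Longrightarrow> eval_poly g b = 0"
    then obtain c where "b = c *s a" using line by blast
    then show "eval_poly (var k - poly_scale (?a $ k) (var j)) b = 0"
      using j by (simp add: eval_poly_linear_simps)
  qed
  then have "f - poly_scale (eval_poly f ?a) (var j ^ d) \<in> ?I"
    using span f by (intro homogeneous_cong_var_power ideal_point_ideal) auto
  then show "f \<in> ?I"
    by (simp add: eval_poly_homogeneous[OF f] eval)
qed (use a(2) eval_poly_point_ideal in blast)

section \<open>Hilbert functions\<close>

text \<open>The dimension in \<open>hilbert_function\<close> takes its scalars from a subfield of
  the ring; this is the copy of \<open>k\<close> among the polynomials.\<close>

lemma subfield_constants: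
  "subfield (range (Poly_Mapping.single 0)) (poly_ring :: ('x::finite, 'k::field) polys ring)"
proof (rule poly_ring.subfieldI)
  let ?K = "range (Poly_Mapping.single 0) :: ('x, 'k) polys set"
  show "subcring ?K poly_ring"
  proof (rule poly_ring.subcringI)
    show "subring ?K poly_ring"
    proof (rule poly_ring.subringI)
      show "\<ominus>\<^bsub>poly_ring\<^esub> h \<in> ?K" if h: "h \<in> ?K" for h
      proof -
        have "\<ominus>\<^bsub>poly_ring\<^esub> h = - h"
          by (rule poly_ring.minus_equality) simp_all
        then show ?thesis using h by (auto simp flip: single_uminus)
      qed
      show "\<one>\<^bsub>poly_ring\<^esub> \<in> ?K" by (simp add: image_iff, rule exI[of _ 1]) simp
    qed (auto simp: mult_single simp flip: single_add)
  qed (auto simp: mult.commute)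
  show "Units (poly_ring\<lparr>carrier := ?K\<rparr>) = ?K - {\<zero>\<^bsub>poly_ring\<^esub>}"
  proof
    show "Units (poly_ring\<lparr>carrier := ?K\<rparr>) \<subseteq> ?K - {\<zero>\<^bsub>poly_ring\<^esub>}"
      by (auto simp: Units_def)
    show "?K - {\<zero>\<^bsub>poly_ring\<^esub>} \<subseteq> Units (poly_ring\<lparr>carrier := ?K\<rparr>)"
    proof
      fix f assume "f \<in> ?K - {\<zero>\<^bsub>poly_ring\<^esub>}"
      then obtain c :: 'k where c: "f = Poly_Mapping.single 0 c" "c \<noteq> 0"
        by (metis DiffE imageE poly_ring_simps(4) singletonI single_zero)
      have "f * Poly_Mapping.single 0 (inverse c) = 1" "Poly_Mapping.single 0 (inverse c) * f = 1"
        using c by (simp_all add: mult_single)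
      then show "f \<in> Units (poly_ring\<lparr>carrier := ?K\<rparr>)"
        using c by (auto simp: Units_def)
    qed
  qed
qed

text \<open>\<open>dimension\<close> grows by adjoining one vector at a time, and the line extension
  of \<open>pv.span S\<close> by \<open>f\<close> is \<open>pv.span (insert f S)\<close>.\<close>

lemma dimension_span:
  fixes S :: "('x::finite, 'k::field) polys set"
  assumes "finite S" "pv.independent S"
  shows "ring.dimension poly_ring (card S) (range (Poly_Mapping.single 0)) (pv.span S)"
  using assms
proof (induction S)
  case empty
  then show ?case using poly_ring.zero_dim by simp
next
  case (insert f S)
  let ?K = "range (Poly_Mapping.single 0) :: ('x, 'k) polys set"
  have "poly_ring.line_extension ?K f (pv.span S) = pv.span (insert f S)"
  proof -
    have "(\<exists>c. g - poly_scale c f \<in> pv.span S) \<longleftrightarrow> (\<exists>c. \<exists>h\<in>pv.span S. g = poly_scale c f + h)" for g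
      by (metis add_diff_cancel_left' diff_add_cancel add.commute)
    then show ?thesis
      unfolding set_eq_iff poly_ring.line_extension_mem_iff pv.span_insert poly_scale_def by auto
  qed
  moreover have "f \<notin> pv.span S" "pv.independent S"
    using insert.prems insert.hyps pv.independent_insert[of f S] by auto
  ultimately show ?case
    using poly_ring.Suc_dim[of f "pv.span S" "card S" ?K] insert by simp
qed

text \<open>The classes of \<open>S\<close> form a basis of the degree \<open>d\<close> part of the
  quotient: the trivial intersection with \<open>I\<close> gives injectivity on the span, the last
  assumption surjectivity. By \<open>1 \<notin> I\<close> the quotient is nontrivial, so the
  constants remain a field there.\<close>

lemma hilbert_function_eq_card:
  fixes I :: "('x::finite, 'k::field) polys set"
  assumes I: "ideal I poly_ring" "1 \<notin> I"
    and S: "finite S" "pv.independent S" "S \<subseteq> graded_part d" "pv.span S \<inter> I = {0}"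
    and span: "\<And>f. f \<in> graded_part d \<Longrightarrow> \<exists>g\<in>pv.span S. f - g \<in> I"
  shows "hilbert_function I d = card S"
proof -
  let ?K = "range (Poly_Mapping.single 0) :: ('x, 'k) polys set"
  let ?Q = "poly_ring Quot I"
  let ?h = "a_r_coset poly_ring I"
  interpret h: ring_hom_ring poly_ring ?Q ?h
    by (rule ideal.rcos_ring_hom_ring[OF I(1)])
  have coset_eq: "?h f = ?h g \<longleftrightarrow> f - g \<in> I" for f g
  proof -
    have "f \<ominus>\<^bsub>poly_ring\<^esub> g = f - g"
      using poly_ring.minus_equality[of "- g" g] by (simp add: a_minus_def)
    then show ?thesis
      using poly_ring.quotient_eq_iff_same_a_r_cos[OF I(1), of f g] by auto
  qed
  have "\<zero>\<^bsub>?Q\<^esub> = ?h 0" by (metis h.hom_zero poly_ring_simps(4))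
  have one: "\<one>\<^bsub>?Q\<^esub> \<noteq> \<zero>\<^bsub>?Q\<^esub>"
    using coset_eq[of 1 0] I(2) h.hom_zero h.hom_one by simp
  have span_graded: "pv.span S \<subseteq> graded_part d"
    by (rule pv.span_minimal[OF S(3) subspace_graded_part])
  have "inj_on ?h (pv.span S)"
  proof (rule inj_onI)
    fix f g assume "f \<in> pv.span S" "g \<in> pv.span S" "?h f = ?h g"
    then have "f - g \<in> pv.span S \<inter> I" by (simp add: coset_eq pv.span_diff)
    then show "f = g" using S(4) by auto
  qed
  then have dim: "h.dimension (card S) (?h ` ?K) (?h ` pv.span S)"
    by (rule h.inj_hom_dimension[OF subfield_constants one _ dimension_span[OF S(1,2)]])
  have "?h ` pv.span S = ?h ` graded_part d"
  proof
    show "?h ` graded_part d \<subseteq> ?h ` pv.span S"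
    proof
      fix y assume "y \<in> ?h ` graded_part d"
      then obtain f where "f \<in> graded_part d" "y = ?h f" by blast
      then show "y \<in> ?h ` pv.span S" using span[of f] coset_eq[of f] by blast
    qed
  qed (use span_graded in blast)
  moreover have "?h ` ?K = range (\<lambda>c. ?h (Poly_Mapping.single 0 c))" by auto
  ultimately show ?thesis
    using h.dimI[OF h.img_is_subfield(2)[OF subfield_constants one] dim]
    unfolding hilbert_function_def over_def by simp
qed

section \<open>Families of polynomials dual to a set of points\<close>

context
  fixes g :: "'i \<Rightarrow> ('x::finite, 'k::field) polys" and q :: "'i \<Rightarrow> 'k ^ 'x" and A :: "'i set"
  assumes finite: "finite A"
    and dual: "\<And>i j. i \<in> A \<Longrightarrow> j \<in> A \<Longrightarrow> eval_poly (g i) (q j) = 0 \<longleftrightarrow> i \<noteq> j"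
begin

text \<open>Evaluation at \<open>q j\<close> isolates the coefficient of \<open>g j\<close>; the
  zero test, independence and interpolation below all rest on this.\<close>

lemma dual_family_eval_sum:
  assumes "j \<in> A"
  shows "eval_poly (\<Sum>i\<in>A. poly_scale (c i) (g i)) (q j) = c j * eval_poly (g j) (q j)"
proof -
  have "(\<Sum>i\<in>A. c i * eval_poly (g i) (q j)) = (\<Sum>i\<in>A. if i = j then c j * eval_poly (g j) (q j) else 0)"
    by (rule sum.cong) (use dual assms in auto)
  then show ?thesis
    using assms finite by (simp add: eval_poly_linear_simps)
qed

lemma dual_family_inj: "inj_on g A"
proof (rule inj_onI)
  fix i j assume "i \<in> A" "j \<in> A" "g i = g j"
  then show "i = j" using dual[of i i] dual[of j i] by metis
qed

lemma dual_family_span_zero: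
  assumes "f \<in> pv.span (g ` A)" "\<And>j. j \<in> A \<Longrightarrow> eval_poly f (q j) = 0"
  shows "f = 0"
proof -
  obtain u where "f = (\<Sum>h\<in>g ` A. poly_scale (u h) h)"
    using assms(1) pv.span_finite[OF finite_imageI[OF finite, of g]] by auto
  then have f: "f = (\<Sum>i\<in>A. poly_scale (u (g i)) (g i))"
    by (simp add: sum.reindex dual_family_inj)
  then have "u (g j) = 0" if "j \<in> A" for j
    using dual_family_eval_sum[of j "\<lambda>i. u (g i)"] assms(2)[of j] dual[of j j] that by simp
  then show ?thesis using f by simp
qed

lemma dual_family_independent: "pv.independent (g ` A)"
proof (rule pv.independent_if_scalars_zero)
  fix u h assume sum: "(\<Sum>h\<in>g ` A. poly_scale (u h) h) = 0" and "h \<in> g ` A"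
  then obtain j where j: "j \<in> A" "h = g j" by auto
  have "(\<Sum>i\<in>A. poly_scale (u (g i)) (g i)) = 0"
    using sum by (simp add: sum.reindex dual_family_inj)
  then show "u h = 0"
    using dual_family_eval_sum[of j "\<lambda>i. u (g i)"] dual[of j j] j by (simp add: eval_poly_linear_simps)
qed (use finite in simp)

text \<open>Lagrange interpolation; the diagonal values are nonzero but arbitrary, hence the
  division. The explicit sum is kept because \<open>vanishing_at_block\<close> argues with its
  coefficients.\<close>

lemma dual_family_interpolate:
  obtains h where "h \<in> pv.span (g ` A)" "\<And>j. j \<in> A \<Longrightarrow> eval_poly h (q j) = y j"
    "h = (\<Sum>i\<in>A. poly_scale (y i / eval_poly (g i) (q i)) (g i))"
proof
  show "(\<Sum>i\<in>A. poly_scale (y i / eval_poly (g i) (q i)) (g i)) \<in> pv.span (g ` A)"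
    by (intro pv.span_sum, intro pv.span_scale, intro pv.span_base) auto
  show "eval_poly (\<Sum>i\<in>A. poly_scale (y i / eval_poly (g i) (q i)) (g i)) (q j) = y j" if "j \<in> A" for j
    using dual_family_eval_sum[OF that, of "\<lambda>i. y i / eval_poly (g i) (q i)"] dual[of j j] that by simp
qed simp

end

section \<open>Star configurations\<close>

text \<open>The geometry reduced to vectors: \<open>p \<sigma>\<close> represents the point of index
  \<open>\<sigma>\<close>, \<open>eval_form\<close> is general position, and
  \<open>point_ideal_iff\<close> turns ideal membership into evaluation.\<close>

locale star_configuration =
  fixes l :: "nat \<Rightarrow> ('x::finite, 'k::field) polys" and p :: "nat set \<Rightarrow> 'k ^ 'x" and n v :: nat
  assumes linear_form: "i \<in> {1..v} \<Longrightarrow> l i \<in> graded_part 1"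
    and card_vars: "CARD('x) = n + 1"
    and point_nonzero: "\<sigma> \<in> subsets_of_size n v \<Longrightarrow> p \<sigma> \<noteq> 0"
    and eval_form: "\<sigma> \<in> subsets_of_size n v \<Longrightarrow> i \<in> {1..v} \<Longrightarrow> eval_poly (l i) (p \<sigma>) = 0 \<longleftrightarrow> i \<in> \<sigma>"
    and point_ideal_iff: "\<sigma> \<in> subsets_of_size n v \<Longrightarrow> f \<in> graded_part d \<Longrightarrow>
      f \<in> point_ideal l \<sigma> \<longleftrightarrow> eval_poly f (p \<sigma>) = 0"
begin

definition complement_form :: "nat set \<Rightarrow> nat set \<Rightarrow> ('x, 'k) polys" where
  "complement_form W \<sigma> = (\<Prod>i\<in>W - \<sigma>. l i)"

lemma finite_subsets_of_size: "finite (subsets_of_size m u)"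
  by (rule finite_subset[of _ "Pow {1..u}"]) (auto simp: subsets_of_size_def)

text \<open>A product vanishes iff a factor does. \<open>\<tau>\<close> ranges beyond
  \<open>W\<close> since \<open>vanishing_at_block\<close> evaluates at a point with an index
  outside \<open>W\<close>.\<close>

lemma eval_complement_form:
  assumes "W \<subseteq> {1..v}" "\<tau> \<in> subsets_of_size n v"
  shows "eval_poly (complement_form W \<sigma>) (p \<tau>) = 0 \<longleftrightarrow> \<not> W \<inter> \<tau> \<subseteq> \<sigma>"
proof -
  have "finite (W - \<sigma>)" using assms(1) finite_subset by blast
  then have "eval_poly (complement_form W \<sigma>) (p \<tau>) = 0 \<longleftrightarrow> (\<exists>i\<in>W - \<sigma>. eval_poly (l i) (p \<tau>) = 0)"
    by (simp add: complement_form_def eval_poly_prod prod_zero_iff)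
  also have "\<dots> \<longleftrightarrow> (\<exists>i\<in>W - \<sigma>. i \<in> \<tau>)"
    using eval_form[OF assms(2)] assms(1) by blast
  finally show ?thesis by blast
qed

context
  fixes W assumes W: "W \<subseteq> {1..v}" "n \<le> card W"
begin

definition points where "points = {\<sigma>. \<sigma> \<subseteq> W \<and> card \<sigma> = n}"

lemma finite_W: "finite W"
  using W(1) finite_subset by blast

lemma finite_points: "finite points"
  unfolding points_def using finite_W by simp

lemma points_subset: "points \<subseteq> subsets_of_size n v"
  using W(1) by (auto simp: points_def subsets_of_size_def)

text \<open>Both index sets have \<open>n\<close> elements, so
  \<open>\<tau> \<subseteq> \<sigma>\<close> forces equality.\<close>

lemma complement_form_dual:
  assumes "\<sigma> \<in> points" "\<tau> \<in> points"
  shows "eval_poly (complement_form W \<sigma>) (p \<tau>) = 0 \<longleftrightarrow> \<sigma> \<noteq> \<tau>"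
proof -
  have "\<tau> \<subseteq> W" "\<tau> \<in> subsets_of_size n v" "finite \<sigma>" "card \<sigma> = card \<tau>"
    using assms points_subset finite_W finite_subset by (auto simp: points_def)
  moreover have "\<tau> \<subseteq> \<sigma> \<longleftrightarrow> \<sigma> = \<tau>"
    using calculation(3,4) card_subset_eq[of \<sigma> \<tau>] by auto
  ultimately show ?thesis using eval_complement_form[OF W(1)] by (simp add: Int_absorb1)
qed

lemma complement_form_graded:
  assumes "\<sigma> \<in> points"
  shows "complement_form W \<sigma> \<in> graded_part (card W - n)"
proof -
  have "card (W - \<sigma>) = card W - n"
    using assms finite_subset[of \<sigma>, OF _ finite_W] by (auto simp: points_def card_Diff_subset)
  moreover have "complement_form W \<sigma> \<in> graded_part (card (W - \<sigma>))"
    unfolding complement_form_def using W(1) finite_W by (intro graded_part_prod linear_form) auto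
  ultimately show ?thesis by simp
qed

text \<open>The forms dual to the points are as many as the monomials of their degree, so they form a
  basis.\<close>

lemma span_complement_forms: "pv.span (complement_form W ` points) = graded_part (card W - n)"
proof
  let ?S = "complement_form W ` points"
  let ?d = "card W - n"
  show "pv.span ?S \<subseteq> graded_part ?d"
    by (rule pv.span_minimal) (auto simp: complement_form_graded subspace_graded_part)
  show "graded_part ?d \<subseteq> pv.span ?S"
  proof (rule ccontr)
    assume "\<not> graded_part ?d \<subseteq> pv.span ?S"
    then obtain f where f: "f \<in> graded_part ?d" "f \<notin> pv.span ?S" by blast
    have ind: "pv.independent (insert f ?S)"
      using f(2) dual_family_independent[OF finite_points complement_form_dual]
      by (rule pv.independent_insertI)
    have "insert f ?S \<subseteq> pv.span (monomial_basis ?d)"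
      using f(1) complement_form_graded by (auto simp: span_monomial_basis)
    then have "card (insert f ?S) \<le> card (monomial_basis ?d :: ('x, 'k) polys set)"
      using ind by (intro pv.independent_span_bound[THEN conjunct2]) auto
    \<comment> \<open>In \<open>n + 1\<close> variables there are
      \<open>card W choose (card W - n)\<close> monomials of degree
      \<open>card W - n\<close>.\<close>
    also have "\<dots> = card W choose n"
      using binomial_symmetric[OF W(2)] W(2) by (simp add: card_monomial_basis card_vars)
    also have "\<dots> = card ?S"
      using n_subsets[OF finite_W] card_image[OF dual_family_inj[OF finite_points complement_form_dual]]
      by (simp add: points_def)
    also have "\<dots> < card (insert f ?S)"
      using f(2) finite_points pv.span_base[of f ?S] by (subst card_insert_disjoint) auto
    finally show False by simp
  qed
qed

lemma unisolvence:
  assumes "f \<in> graded_part (card W - n)" "\<And>\<sigma>. \<sigma> \<in> points \<Longrightarrow> eval_poly f (p \<sigma>) = 0"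
  shows "f = 0"
  using dual_family_span_zero[OF finite_points complement_form_dual] assms span_complement_forms by blast

text \<open>The interpolant has the degree of \<open>f\<close> and its values at the points, so
  \<open>unisolvence\<close> identifies the two.\<close>

lemma interpolation:
  assumes f: "f \<in> graded_part (card W - n)"
  shows "f = (\<Sum>\<sigma>\<in>points. poly_scale (eval_poly f (p \<sigma>) / eval_poly (complement_form W \<sigma>) (p \<sigma>))
    (complement_form W \<sigma>))"
proof -
  obtain h where h: "h \<in> pv.span (complement_form W ` points)"
    "\<And>\<sigma>. \<sigma> \<in> points \<Longrightarrow> eval_poly h (p \<sigma>) = eval_poly f (p \<sigma>)"
    "h = (\<Sum>\<sigma>\<in>points. poly_scale (eval_poly f (p \<sigma>) / eval_poly (complement_form W \<sigma>) (p \<sigma>))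
      (complement_form W \<sigma>))"
    using dual_family_interpolate[OF finite_points complement_form_dual, of "\<lambda>\<sigma>. eval_poly f (p \<sigma>)"] by blast
  have "f - h \<in> graded_part (card W - n)"
    using f h(1) by (simp add: span_complement_forms pv.subspace_diff subspace_graded_part)
  then have "f - h = 0"
    by (rule unisolvence) (simp add: eval_poly_linear_simps h(2))
  then show ?thesis using h(3) by simp
qed

end

end

section \<open>Complements of Steiner configurations\<close>

text \<open>The Steiner property enters as \<open>blocks_eq\<close>: for \<open>t < n\<close> a set
  of size \<open>n - 1\<close> contains a \<open>t\<close>-set, hence lies in at most one
  block.\<close>

locale sparse_complement = star_configuration l p n v
  for l :: "nat \<Rightarrow> ('x::finite, 'k::field) polys" and p :: "nat set \<Rightarrow> 'k ^ 'x" and n v :: nat +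
  fixes B C :: "nat set set"
  assumes n_pos: "0 < n" and n_le_v: "n \<le> v"
    and blocks: "B \<subseteq> subsets_of_size n v" and blocks_nonempty: "B \<noteq> {}"
    and blocks_eq: "b \<in> B \<Longrightarrow> b' \<in> B \<Longrightarrow> \<rho> \<subseteq> b \<Longrightarrow> \<rho> \<subseteq> b' \<Longrightarrow> card \<rho> = n - 1 \<Longrightarrow> b = b'"
    and C_eq: "C = subsets_of_size n v - B"
begin

lemma config_ideal_iff:
  assumes "f \<in> graded_part d"
  shows "f \<in> config_ideal l C \<longleftrightarrow> (\<forall>\<sigma>\<in>C. eval_poly f (p \<sigma>) = 0)"
  using point_ideal_iff[OF _ assms] by (auto simp: config_ideal_def C_eq)

text \<open>Expand \<open>f\<close> in the basis belonging to a set \<open>W \<supseteq> b\<close> that misses \<open>x\<close>; only blocks occur. At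
  the point of \<open>b - {y} \<union> {x}\<close>, which is not a block, all basis elements but that of \<open>b\<close>
  vanish.\<close>

lemma vanishing_at_block:
  assumes f: "f \<in> graded_part s" "\<And>\<sigma>. \<sigma> \<in> C \<Longrightarrow> eval_poly f (p \<sigma>) = 0"
    and s: "s + n < v" and b: "b \<in> B"
  shows "eval_poly f (p b) = 0"
proof -
  have b': "b \<subseteq> {1..v}" "card b = n" "b \<in> subsets_of_size n v" "finite b"
    using b blocks finite_subset[of b "{1..v}"] by (auto simp: subsets_of_size_def)
  \<comment> \<open>The size makes \<open>s = card W - n\<close> the degree of the dual forms of
    \<open>W\<close>, while \<open>s + n < v\<close> leaves an index outside
    \<open>W\<close>.\<close>
  obtain W where W: "b \<subseteq> W" "W \<subseteq> {1..v}" "card W = s + n"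
    using exists_subset_between[of b "s + n" "{1..v}"] b' s by auto
  then have "W \<noteq> {1..v}" using s by auto
  then obtain x where x: "x \<in> {1..v}" "x \<notin> W" using W(2) by blast
  obtain y where y: "y \<in> b" using b' n_pos by fastforce
  let ?\<tau> = "insert x (b - {y})"
  have card_by: "card (b - {y}) = n - 1" using b' y by simp
  have "x \<notin> b" using W x by blast
  then have tau: "?\<tau> \<in> subsets_of_size n v"
    using b' x n_pos card_by by (auto simp: subsets_of_size_def)
  \<comment> \<open>\<open>?\<tau>\<close> shares the \<open>(n-1)\<close>-set
    \<open>b - {y}\<close> with \<open>b\<close> but also contains \<open>x\<close>.\<close>
  have "?\<tau> \<notin> B"
    using blocks_eq[OF b, of ?\<tau> "b - {y}"] card_by \<open>x \<notin> b\<close> by blast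
  then have f_tau: "eval_poly f (p ?\<tau>) = 0" using f(2) tau by (auto simp: C_eq)
  have nW: "n \<le> card W" using W by simp
  note pts = points_subset[OF W(2) nW] finite_points[OF W(2) nW]
  let ?F = "complement_form W"
  have bW: "b \<in> points W" using W b' by (simp add: points_def[OF W(2) nW])
  define c where "c = (\<lambda>\<sigma>. eval_poly f (p \<sigma>) / eval_poly (?F \<sigma>) (p \<sigma>))"
  have f_eq: "f = (\<Sum>\<sigma>\<in>points W. poly_scale (c \<sigma>) (?F \<sigma>))"
    unfolding c_def using interpolation[OF W(2) nW, of f] f(1) W(3) by simp
  have "0 = eval_poly f (p ?\<tau>)" using f_tau by simp
  also have "\<dots> = (\<Sum>\<sigma>\<in>points W. c \<sigma> * eval_poly (?F \<sigma>) (p ?\<tau>))"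
    by (subst f_eq) (simp add: eval_poly_linear_simps)
  also have "\<dots> = (\<Sum>\<sigma>\<in>points W. if \<sigma> = b then c b * eval_poly (?F b) (p ?\<tau>) else 0)"
  proof (rule sum.cong)
    fix \<sigma> assume \<sigma>: "\<sigma> \<in> points W"
    show "c \<sigma> * eval_poly (?F \<sigma>) (p ?\<tau>) = (if \<sigma> = b then c b * eval_poly (?F b) (p ?\<tau>) else 0)"
    proof (cases "\<sigma> \<in> C")
      case True
      then show ?thesis using f(2) b by (auto simp: c_def C_eq)
    next
      case False
      then have "\<sigma> \<in> B" using \<sigma> pts(1) by (auto simp: C_eq)
      have "eval_poly (?F \<sigma>) (p ?\<tau>) = 0" if "\<sigma> \<noteq> b"
      proof -
        \<comment> \<open>Distinct blocks cannot share \<open>b - {y}\<close>, which lies in both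
          \<open>W\<close> and \<open>?\<tau>\<close>; so some factor of \<open>?F \<sigma>\<close>
          vanishes at \<open>p ?\<tau>\<close>.\<close>
        have "\<not> b - {y} \<subseteq> \<sigma>" using blocks_eq[OF \<open>\<sigma> \<in> B\<close> b _ _ card_by] that by blast
        then show ?thesis
          using eval_complement_form[OF W(2) tau] W(1) by blast
      qed
      then show ?thesis by auto
    qed
  qed simp
  also have "\<dots> = c b * eval_poly (?F b) (p ?\<tau>)" using bW pts(2) by simp
  \<comment> \<open>As \<open>x\<close> is outside \<open>W\<close>, the set
    \<open>W \<inter> ?\<tau>\<close> is contained in \<open>b\<close>, so \<open>?F b\<close> does
    not vanish at \<open>p ?\<tau>\<close>.\<close>
  finally have "c b = 0"
    using eval_complement_form[OF W(2) tau, of b] x(2) by auto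
  then show ?thesis
    using complement_form_dual[OF W(2) nW bW bW] by (simp add: c_def)
qed

text \<open>By \<open>vanishing_at_block\<close>, \<open>f\<close> vanishes at the blocks too, hence
  at all points of any \<open>W\<close> of size \<open>s + n\<close>, and \<open>unisolvence\<close>
  applies.\<close>

lemma vanishing_on_complement:
  assumes f: "f \<in> graded_part s" "\<And>\<sigma>. \<sigma> \<in> C \<Longrightarrow> eval_poly f (p \<sigma>) = 0"
    and s: "s + n < v"
  shows "f = 0"
proof -
  obtain W where W: "W \<subseteq> {1..v}" "card W = s + n"
    using s by (metis card_atLeastAtMost diff_Suc_1 less_imp_le obtain_subset_with_card_n)
  have "eval_poly f (p \<sigma>) = 0" if "\<sigma> \<in> points W" for \<sigma>
    using points_subset[OF W(1)] W(2) that f vanishing_at_block[OF f s] by (cases "\<sigma> \<in> B") (auto simp: C_eq)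
  then show ?thesis using unisolvence[OF W(1)] W(2) f(1) by simp
qed

section \<open>Initial degree, Hilbert function and regularity\<close>

abbreviation (input) full where "full \<equiv> {1..v}"

lemma points_full: "points full = subsets_of_size n v"
  using n_le_v by (simp add: points_def subsets_of_size_def)

text \<open>The form of a block attains the degree, and \<open>vanishing_on_complement\<close>
  excludes smaller ones. For \<open>v = n\<close> that form is the empty product 1.\<close>

lemma initial_degree_complement: "initial_degree (config_ideal l C) = v - n"
  unfolding initial_degree_def
proof (rule Least_equality)
  obtain b where b: "b \<in> B" "b \<in> subsets_of_size n v" using blocks blocks_nonempty by blast
  let ?f = "complement_form full b"
  have graded: "?f \<in> graded_part (v - n)"
    using complement_form_graded[of full b] b(2) n_le_v points_full by simp
  have dual: "eval_poly ?f (p \<sigma>) = 0 \<longleftrightarrow> b \<noteq> \<sigma>" if "\<sigma> \<in> subsets_of_size n v" for \<sigma>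
    using complement_form_dual[of full b \<sigma>] that b(2) n_le_v points_full by simp
  have "?f \<in> config_ideal l C"
    using config_ideal_iff[OF graded] dual b(1) by (auto simp: C_eq)
  moreover have "?f \<noteq> 0" using dual[OF b(2)] by (auto simp: eval_poly_linear_simps)
  ultimately show "\<exists>f\<in>config_ideal l C \<inter> graded_part (v - n). f \<noteq> 0" using graded by blast
next
  fix d assume "\<exists>f\<in>config_ideal l C \<inter> graded_part d. f \<noteq> 0"
  then show "v - n \<le> d"
    using vanishing_on_complement[of _ d] config_ideal_iff[of _ d] by (metis IntE add.commute less_diff_conv not_le_imp_less)
qed

lemma one_notin_config_ideal: "C \<noteq> {} \<Longrightarrow> 1 \<notin> config_ideal l C"
  using config_ideal_iff[OF one_in_graded_part] by simp

text \<open>The ideal has no nonzero form of this degree, so the monomials stay independent in the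
  quotient.\<close>

lemma hilbert_function_small:
  assumes "C \<noteq> {}" "d + n < v"
  shows "hilbert_function (config_ideal l C) d = (d + n) choose d"
proof -
  have "pv.span (monomial_basis d) \<inter> config_ideal l C = {0}"
    using vanishing_on_complement[OF _ _ assms(2)] config_ideal_iff[of _ d]
      ideal_zero[OF ideal_config_ideal[OF assms(1)]] pv.span_zero[of "monomial_basis d"]
    by (auto simp: span_monomial_basis)
  then have "hilbert_function (config_ideal l C) d = card (monomial_basis d :: ('x, 'k) polys set)"
  proof (intro hilbert_function_eq_card ideal_config_ideal one_notin_config_ideal
      independent_monomial_basis assms(1))
    show "monomial_basis d \<subseteq> (graded_part d :: ('x, 'k) polys set)"
      using pv.span_superset[of "monomial_basis d"] by (simp only: span_monomial_basis)
    show "\<exists>h\<in>pv.span (monomial_basis d). f - h \<in> config_ideal l C" if "f \<in> graded_part d" for f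
      using that ideal_zero[OF ideal_config_ideal[OF assms(1)]]
      by (intro bexI[of _ f]) (simp_all add: span_monomial_basis)
  qed auto
  then show ?thesis by (simp add: card_monomial_basis card_vars)
qed

text \<open>In these degrees there are forms dual to the points, so their classes form a basis of
  the graded part of the quotient.\<close>

lemma hilbert_function_large:
  assumes "C \<noteq> {}" "v \<le> d + n"
  shows "hilbert_function (config_ideal l C) d = card C"
proof -
  have C_sub: "C \<subseteq> subsets_of_size n v" by (auto simp: C_eq)
  then have finC: "finite C" using finite_subsets_of_size finite_subset by blast
  have "\<exists>j. p \<sigma> $ j \<noteq> 0" if "\<sigma> \<in> C" for \<sigma>
    using point_nonzero[of \<sigma>] that C_sub by (auto simp: vec_eq_iff)
  then obtain j where j: "\<And>\<sigma>. \<sigma> \<in> C \<Longrightarrow> p \<sigma> $ j \<sigma> \<noteq> 0" by metis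
  \<comment> \<open>The power pads the degree from \<open>v - n\<close> to \<open>d\<close>;
    coordinate \<open>j \<sigma>\<close> is nonzero at \<open>p \<sigma>\<close>, so duality
    survives.\<close>
  define g where "g = (\<lambda>\<sigma>. complement_form full \<sigma> * var (j \<sigma>) ^ (d - (v - n)))"
  have g_graded: "g \<sigma> \<in> graded_part d" if "\<sigma> \<in> C" for \<sigma>
  proof -
    have "complement_form full \<sigma> \<in> graded_part (v - n)"
      using complement_form_graded[of full \<sigma>] that C_sub n_le_v points_full by auto
    from graded_part_mult[OF this graded_part_power[OF var_in_graded_part, where e = "d - (v - n)"]]
    show ?thesis using assms(2) unfolding g_def by simp
  qed
  have dual: "eval_poly (g \<sigma>) (p \<tau>) = 0 \<longleftrightarrow> \<sigma> \<noteq> \<tau>" if "\<sigma> \<in> C" "\<tau> \<in> C" for \<sigma> \<tau>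
    using complement_form_dual[of full \<sigma> \<tau>] that C_sub n_le_v points_full j[of \<sigma>]
    by (auto simp: g_def eval_poly_mult eval_poly_power)
  have span_graded: "pv.span (g ` C) \<subseteq> graded_part d"
    by (rule pv.span_minimal) (auto simp: g_graded subspace_graded_part)
  have "hilbert_function (config_ideal l C) d = card (g ` C)"
  proof (rule hilbert_function_eq_card)
    show "pv.independent (g ` C)" using finC dual by (rule dual_family_independent)
    show "pv.span (g ` C) \<inter> config_ideal l C = {0}"
      using dual_family_span_zero[OF finC dual] config_ideal_iff[of _ d] span_graded pv.span_zero[of "g ` C"]
        ideal_zero[OF ideal_config_ideal[OF assms(1)]] by blast
    fix f :: "('x, 'k) polys" assume f: "f \<in> graded_part d"
    obtain h where h: "h \<in> pv.span (g ` C)" "\<And>\<sigma>. \<sigma> \<in> C \<Longrightarrow> eval_poly h (p \<sigma>) = eval_poly f (p \<sigma>)"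
      using dual_family_interpolate[OF finC dual, of "\<lambda>\<sigma>. eval_poly f (p \<sigma>)"] by blast
    have "f - h \<in> graded_part d"
      using f h(1) span_graded by (blast intro: pv.subspace_diff subspace_graded_part)
    then have "f - h \<in> config_ideal l C"
      by (simp add: config_ideal_iff h(2) eval_poly_linear_simps)
    then show "\<exists>h\<in>pv.span (g ` C). f - h \<in> config_ideal l C" using h(1) by blast
  qed (use finC assms g_graded ideal_config_ideal one_notin_config_ideal in auto)
  also have "\<dots> = card C" using dual_family_inj[OF finC dual] by (rule card_image)
  finally show ?thesis .
qed

text \<open>Each block has \<open>n\<close> subsets of size \<open>n - 1\<close> and distinct blocks
  share none, so \<open>n * card B\<close> is at most \<open>v choose (n - 1)\<close>. For
  \<open>n = 1\<close> the claim would read \<open>card B < 1\<close>, contradicting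
  \<open>blocks_nonempty\<close>.\<close>

lemma card_blocks_less:
  assumes "2 \<le> n" "n < v"
  shows "card B < (v - 1) choose (n - 1)"
proof -
  have finB: "finite B" using blocks finite_subsets_of_size finite_subset by blast
  let ?P = "\<lambda>b. {\<rho>. \<rho> \<subseteq> b \<and> card \<rho> = n - 1}"
  have b: "finite b" "card b = n" "b \<subseteq> full" if "b \<in> B" for b
    using that blocks finite_subset[of b full] by (auto simp: subsets_of_size_def)
  have "card (?P b) = n" if "b \<in> B" for b
    using n_subsets[OF b(1)[OF that], of "n - 1"] b(2)[OF that] n_pos
    by (cases n) simp_all
  then have "n * card B = (\<Sum>b\<in>B. card (?P b))" by simp
  also have "\<dots> = card (\<Union>b\<in>B. ?P b)"
  proof (rule card_UN_disjoint[symmetric, OF finB], goal_cases)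
    case 1
    then show ?case using b(1) by simp
  next
    case 2
    have "?P b \<inter> ?P b' = {}" if "b \<in> B" "b' \<in> B" "b \<noteq> b'" for b b'
      using blocks_eq[OF that(1,2)] that(3) by blast
    then show ?case by blast
  qed
  also have "\<dots> \<le> card {\<rho>. \<rho> \<subseteq> full \<and> card \<rho> = n - 1}"
    using b(3) by (intro card_mono) (simp, blast)
  also have "\<dots> = v choose (n - 1)"
    using n_subsets[of full] by simp
  finally have "(v - (n - 1)) * (n * card B) \<le> (v - (n - 1)) * (v choose (n - 1))"
    by (rule mult_left_mono) simp
  also have "\<dots> = v * ((v - 1) choose (n - 1))"
    by (rule binomial_absorb_comp)
  also have "\<dots> < ((v - (n - 1)) * n) * ((v - 1) choose (n - 1))"
  proof (rule mult_strict_right_mono)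
    \<comment> \<open>The two sides differ by \<open>(n - 1) * (v - n)\<close>, which is positive;
      the substitution removes the subtractions.\<close>
    obtain a c where "n = a + 2" "v = n + 1 + c"
      using assms by (metis add.commute less_iff_Suc_add le_Suc_ex add_Suc_right Suc_eq_plus1)
    then show "v < (v - (n - 1)) * n" by (simp add: algebra_simps)
    show "0 < (v - 1) choose (n - 1)" using assms by (simp add: zero_less_binomial)
  qed
  finally show ?thesis
    by (simp add: mult.assoc[symmetric])
qed

text \<open>Below degree \<open>v - n\<close> this is Pascal's rule. The delicate case is
  \<open>s = v - n\<close>, where the value passes from \<open>(v - 1) choose n\<close> to
  \<open>card C\<close>.\<close>

lemma hilbert_function_strict:
  assumes "2 \<le> n" "0 < s" "s \<le> v - n"
  shows "hilbert_function (config_ideal l C) (s - 1) < hilbert_function (config_ideal l C) s"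
proof -
  have nv: "n < v" using assms by simp
  have cardC: "card C = (v choose n) - card B"
    using blocks finite_subsets_of_size n_subsets[of full n]
    by (simp add: C_eq card_Diff_subset finite_subset[OF blocks] subsets_of_size_def)
  have pascal: "v choose n = ((v - 1) choose (n - 1)) + ((v - 1) choose n)"
    using nv n_pos by (simp add: choose_reduce_nat)
  \<comment> \<open>Removing fewer than \<open>(v - 1) choose (n - 1)\<close> blocks from all
    \<open>v choose n\<close> sets leaves more than \<open>(v - 1) choose n\<close>.\<close>
  have ineq: "(v - 1) choose n < card C"
    using card_blocks_less[OF assms(1) nv] cardC pascal by linarith
  then have C: "C \<noteq> {}" by auto
  show ?thesis
  proof (cases "s + n < v")
    case True
    have "(s + n) choose s = ((s - 1 + n) choose (s - 1)) + ((s - 1 + n) choose s)"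
      using assms(2) by (cases s) simp_all
    moreover have "0 < (s - 1 + n) choose s"
      using assms n_pos by (simp add: zero_less_binomial)
    ultimately show ?thesis
      using True C assms by (simp add: hilbert_function_small)
  next
    case False
    then have s: "s = v - n" using assms by simp
    \<comment> \<open>Here \<open>s - 1 + n = v - 1\<close>, and the complementary lower index is
      \<open>n\<close>.\<close>
    have "(s - 1 + n) choose (s - 1) = (v - 1) choose n"
      using s nv by (subst binomial_symmetric) auto
    then show ?thesis
      using ineq s nv C by (simp add: hilbert_function_small hilbert_function_large)
  qed
qed

text \<open>Strict growth excludes every \<open>s \<le> v - n\<close>; in degrees
  \<open>v - n\<close> and \<open>v - n + 1\<close> the value is the same.\<close>

lemma points_regularity_complement:
  assumes "2 \<le> n"
  shows "points_regularity (config_ideal l C) = v - n + 1"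
  unfolding points_regularity_def
proof (rule Least_equality)
  show "0 < v - n + 1 \<and>
    hilbert_function (config_ideal l C) (v - n + 1) = hilbert_function (config_ideal l C) (v - n + 1 - 1)"
  proof (cases "C = {}")
    case True
    \<comment> \<open>The quotient by the whole ring has a single class, so all degrees give the
      same value.\<close>
    then have "config_ideal l C = UNIV" by (simp add: config_ideal_def)
    then have "a_r_coset poly_ring (config_ideal l C) f = UNIV" for f
      by (auto simp: a_r_coset_def') (metis diff_add_cancel)
    then have "a_r_coset poly_ring (config_ideal l C) ` graded_part d = {UNIV}" for d
      using pv.subspace_0[OF subspace_graded_part, of d] by auto
    then show ?thesis by (simp add: hilbert_function_def)
  next
    case False
    then show ?thesis using n_le_v by (simp add: hilbert_function_large)
  qed
  fix s assume "0 < s \<and> hilbert_function (config_ideal l C) s = hilbert_function (config_ideal l C) (s - 1)"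
  then show "v - n + 1 \<le> s"
    using hilbert_function_strict[OF assms, of s] by (cases "s \<le> v - n") auto
qed

end

section \<open>From hyperplanes to vectors\<close>

lemma hyperplanes_point:
  fixes l :: "nat \<Rightarrow> ('x::finite, 'k::field) polys"
  assumes "\<sigma> \<noteq> {}" and l: "\<And>i. i \<in> \<sigma> \<Longrightarrow> l i \<in> graded_part 1"
    and P: "(\<Inter>i\<in>\<sigma>. hyperplane (l i)) = {P}"
  obtains a where "a \<noteq> 0" "P = vec.span {a}" "\<And>i. i \<in> \<sigma> \<Longrightarrow> eval_poly (l i) a = 0"
    "\<And>b. (\<And>i. i \<in> \<sigma> \<Longrightarrow> eval_poly (l i) b = 0) \<Longrightarrow> \<exists>c. b = c *s a"
proof -
  have P_hyp: "P \<in> hyperplane (l i)" if "i \<in> \<sigma>" for i using P that by blast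
  then have sub: "vec.subspace P" "vec.dim P = 1"
    using \<open>\<sigma> \<noteq> {}\<close> by (auto simp: hyperplane_def proj_space_def)
  obtain A where A: "A \<subseteq> P" "vec.independent A" "P \<subseteq> vec.span A" "card A = 1"
    using vec.basis_exists[of P] sub(2) by metis
  then obtain a where "A = {a}" using card_1_singletonE by blast
  then have a: "a \<noteq> 0" "P = vec.span {a}" "a \<in> P"
    using A sub(1) vec.span_minimal[of A P] by auto
  \<comment> \<open>A nonzero common zero \<open>b\<close> spans a projective point on all the
    hyperplanes, which must be \<open>P\<close>. So the common zeros form a line, as
    \<open>homogeneous_in_point_ideal_iff\<close> requires.\<close>
  have "\<exists>c. b = c *s a" if b: "\<And>i. i \<in> \<sigma> \<Longrightarrow> eval_poly (l i) b = 0" for b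
  proof (cases "b = 0")
    case True
    then show ?thesis by (intro exI[of _ 0]) simp
  next
    case False
    have "vec.span {b} \<in> proj_space" using False by (simp add: proj_space_def)
    then have "vec.span {b} \<in> hyperplane (l i)" if "i \<in> \<sigma>" for i
      using b[OF that] eval_poly_homogeneous[OF l[OF that]]
      by (auto simp: hyperplane_def vec.span_singleton)
    then have "vec.span {b} = P" using P by blast
    then have "b \<in> vec.span {a}" using a(2) vec.span_base[of b "{b}"] by simp
    then show ?thesis by (auto simp: vec.span_singleton)
  qed
  then show ?thesis
    using that[of a] a P_hyp by (auto simp: hyperplane_def)
qed

text \<open>Given that any \<open>n\<close> hyperplanes meet in a point, injectivity of the map from
  \<open>\<sigma>\<close> to its point says that no \<open>n + 1\<close> of them share a point.
  Distinct members of \<open>C\<close> thus index distinct points.\<close>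

theorem corollary4p2:
  fixes t n v :: nat
    and B C :: "nat set set"
    and l :: "nat \<Rightarrow> ('x::finite, 'k::field) polys"
  assumes "steiner_system t n v B"
    and "t < n" and "n \<le> v" and "2 \<le> n"
    and "CARD('x) = n + 1"
    and "\<And>i. i \<in> {1..v} \<Longrightarrow> l i \<in> graded_part 1 \<and> l i \<noteq> 0"
    and "inj_on (\<lambda>i. hyperplane (l i)) {1..v}"
    and "\<And>\<sigma>. \<sigma> \<in> subsets_of_size n v \<Longrightarrow> \<exists>P. (\<Inter>i\<in>\<sigma>. hyperplane (l i)) = {P}"
    and "inj_on (\<lambda>\<sigma>. \<Inter>i\<in>\<sigma>. hyperplane (l i)) (subsets_of_size n v)"
    and "C = subsets_of_size n v - B"
  shows "points_regularity (config_ideal l C) = initial_degree (config_ideal l C) + 1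
    \<and> initial_degree (config_ideal l C) + 1 = v - n + 1"
proof -
  let ?X = "\<lambda>\<sigma>. \<Inter>i\<in>\<sigma>. hyperplane (l i)"
  have l: "l i \<in> graded_part 1" if "i \<in> \<sigma>" "\<sigma> \<in> subsets_of_size n v" for i \<sigma>
    using assms(6)[of i] that by (auto simp: subsets_of_size_def)
  have nonempty: "\<sigma> \<noteq> {}" if "\<sigma> \<in> subsets_of_size n v" for \<sigma>
    using that assms(4) by (auto simp: subsets_of_size_def)
  let ?Q = "\<lambda>\<sigma> a. a \<noteq> 0 \<and> ?X \<sigma> = {vec.span {a}} \<and> (\<forall>i\<in>\<sigma>. eval_poly (l i) a = 0) \<and>
      (\<forall>b. (\<forall>i\<in>\<sigma>. eval_poly (l i) b = 0) \<longrightarrow> (\<exists>c. b = c *s a))"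
  have "\<exists>a. ?Q \<sigma> a" if \<sigma>: "\<sigma> \<in> subsets_of_size n v" for \<sigma>
  proof -
    obtain P where P: "?X \<sigma> = {P}" using assms(8)[OF \<sigma>] by blast
    from hyperplanes_point[OF nonempty[OF \<sigma>] l[OF _ \<sigma>] P]
    obtain a where "a \<noteq> 0" "P = vec.span {a}" "\<And>i. i \<in> \<sigma> \<Longrightarrow> eval_poly (l i) a = 0"
      "\<And>b. (\<And>i. i \<in> \<sigma> \<Longrightarrow> eval_poly (l i) b = 0) \<Longrightarrow> \<exists>c. b = c *s a" by metis
    then show ?thesis unfolding P by (intro exI[of _ a]) simp
  qed
  then have "\<exists>p. \<forall>\<sigma>\<in>subsets_of_size n v. ?Q \<sigma> (p \<sigma>)"
    by (intro bchoice ballI)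
  then obtain p where p_all: "\<forall>\<sigma>\<in>subsets_of_size n v. ?Q \<sigma> (p \<sigma>)" ..
  have p: "p \<sigma> \<noteq> 0" "?X \<sigma> = {vec.span {p \<sigma>}}"
      "\<And>i. i \<in> \<sigma> \<Longrightarrow> eval_poly (l i) (p \<sigma>) = 0"
      "\<And>b. (\<And>i. i \<in> \<sigma> \<Longrightarrow> eval_poly (l i) b = 0) \<Longrightarrow> \<exists>c. b = c *s p \<sigma>"
    if "\<sigma> \<in> subsets_of_size n v" for \<sigma>
    using bspec[OF p_all that] by blast+
  \<comment> \<open>If a further hyperplane \<open>i\<close> passed through the point of
    \<open>\<sigma>\<close>, exchanging some \<open>j \<in> \<sigma>\<close> for \<open>i\<close>
    would give a second index set with the same point.\<close>
  have nonvanishing: "eval_poly (l i) (p \<sigma>) \<noteq> 0"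
    if \<sigma>: "\<sigma> \<in> subsets_of_size n v" and i: "i \<in> {1..v}" "i \<notin> \<sigma>" for \<sigma> i
  proof
    assume zero: "eval_poly (l i) (p \<sigma>) = 0"
    obtain j where j: "j \<in> \<sigma>" using nonempty[OF \<sigma>] by blast
    let ?\<sigma>' = "insert i (\<sigma> - {j})"
    have "finite \<sigma>" using \<sigma> finite_subset[of \<sigma> "{1..v}"] by (auto simp: subsets_of_size_def)
    then have \<sigma>': "?\<sigma>' \<in> subsets_of_size n v"
      using \<sigma> i j assms(4) by (auto simp: subsets_of_size_def card_Diff_singleton)
    have "\<exists>c. p \<sigma> = c *s p ?\<sigma>'"
      using zero p(3)[OF \<sigma>] by (intro p(4)[OF \<sigma>']) auto
    then obtain c where c: "p \<sigma> = c *s p ?\<sigma>'" by blast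
    then have "c \<noteq> 0" using p(1)[OF \<sigma>] by auto
    then have "vec.span {p \<sigma>} = vec.span {p ?\<sigma>'}"
      using c vec.span_image_scale[of "{p ?\<sigma>'}" "\<lambda>_. c"] by simp
    then have "\<sigma> = ?\<sigma>'"
      using p(2)[OF \<sigma>] p(2)[OF \<sigma>'] inj_onD[OF assms(9) _ \<sigma> \<sigma>'] by simp
    then show False using i by blast
  qed
  interpret sparse_complement l p n v B C
  proof
    show "\<sigma> \<in> subsets_of_size n v \<Longrightarrow> i \<in> {1..v} \<Longrightarrow> eval_poly (l i) (p \<sigma>) = 0 \<longleftrightarrow> i \<in> \<sigma>" for \<sigma> i
      using p(3) nonvanishing by blast
    show "f \<in> point_ideal l \<sigma> \<longleftrightarrow> eval_poly f (p \<sigma>) = 0"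
      if "\<sigma> \<in> subsets_of_size n v" "f \<in> graded_part d" for \<sigma> f d
      using that l p(1,3,4) by (intro homogeneous_in_point_ideal_iff) blast+
    have unique: "\<exists>!b. b \<in> B \<and> T \<subseteq> b" if "T \<in> subsets_of_size t v" for T
      using assms(1) that by (simp add: steiner_system_def)
    \<comment> \<open>Any \<open>t\<close>-set will do, as it lies in some block.\<close>
    have "{1..t} \<in> subsets_of_size t v" using assms(2,3) by (simp add: subsets_of_size_def)
    then show "B \<noteq> {}" using unique by blast
    show blocks: "B \<subseteq> subsets_of_size n v" using assms(1) by (simp add: steiner_system_def)
    fix b b' \<rho> assume b: "b \<in> B" "b' \<in> B" "\<rho> \<subseteq> b" "\<rho> \<subseteq> b'" "card \<rho> = n - 1"
    \<comment> \<open>By \<open>t < n\<close> the common subset \<open>\<rho>\<close> contains a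
      \<open>t\<close>-set, and that lies in only one block.\<close>
    have "t \<le> card \<rho>" using b(5) assms(2) by simp
    then obtain T where T: "T \<subseteq> \<rho>" "card T = t" by (rule obtain_subset_with_card_n)
    moreover have "b \<subseteq> {1..v}" using b(1) blocks by (auto simp: subsets_of_size_def)
    ultimately have "T \<in> subsets_of_size t v"
      using b(3) by (auto simp: subsets_of_size_def)
    then show "b = b'" using unique b T by blast
  qed (use assms p(1) in auto)
  show ?thesis
    using initial_degree_complement points_regularity_complement[OF assms(4)] by simp
qed

end
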